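(* Let $\mathcal A$, $\mathcal A_1$, $\Phi$, $\{p_\alpha\}_\alpha$, $b$ and $T_{\Phi,b}$ be as in the context. Then the following statements are equivalent: (i) $T_{\Phi,b}$ is hypercyclic on $\mathcal A$. (ii) For every $p_\alpha$ there exist a strictly increasing sequence $\{n_k\}_k\subseteq\mathbb N$ and sequences $\{q_k\}_k$, $\{d_k\}_k$ in $\mathcal A$ such that $$\lim_{k\to\infty}\|q_k-p_\alpha^2\|=\lim_{k\to\infty}\|d_k-p_\alpha^2\|=0$$ and $$\lim_{k\to\infty}\|\Phi^{-n_k}(b)\,\Phi^{-n_k+1}(b)\cdots\Phi^{-1}(b)\,q_k\|=\lim_{k\to\infty}\|\Phi^{n_k-1}(b^{-1})\,\Phi^{n_k-2}(b^{-1})\cdots\Phi(b^{-1})\,b^{-1}d_k\|=0.$$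
   Context: $\mathbb N=\{1,2,\dots\}$. $\mathcal A$ is a non-unital $C^*$-algebra which is a closed two-sided ideal in a unital $C^*$-algebra $\mathcal A_1$. $\Phi$ is an isometric $*$-isomorphism of $\mathcal A_1$ onto itself such that $\Phi(\mathcal A)=\mathcal A$. It is assumed that $\{p_\alpha\}_\alpha\subseteq\mathcal A$ is a net of self-adjoint elements with $\|p_\alpha\|\le 1$ for all $\alpha$, such that $\{p_\alpha^2\}_\alpha$ is an approximate unit for $\mathcal A$, and such that for every $\alpha$ there exists $N_\alpha\in\mathbb N$ with $\Phi^n(p_\alpha)\cdot p_\alpha=0$ for all $n\ge N_\alpha$. $G(\mathcal A_1)$ denotes the group of invertible elements of $\mathcal A_1$, and $b\in G(\mathcal A_1)$. $T_{\Phi,b}$ is the bounded linear operator on $\mathcal A_1$ defined by $T_{\Phi,b}(a)=b\cdot\Phi(a)$; it satisfies $T_{\Phi,b}(\mathcal A)=\mathcal A$ and is regarded as an operator on $\mathcal A$. A bounded linear operator $T$ on a Banach space $\mathcal X$ is hypercyclic if there is $x\in\mathcal X$ whose orbit $\{T^nx : n\in\mathbb N\cup\{0\}\}$ is dense in $\mathcal X$.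
   Formalization: The algebra A is additionally assumed separable; without this (ii) does not imply (i), e.g. for c_0(Z×J) with J uncountable, while (i) always forces A to be separable. *)

theory Defs
  imports "HOL-Analysis.Analysis"
begin

text \<open>
  Unital complex \<open>C\<^sup>*\<close>-algebras.  The superclasses provide completeness, the unit and a
  submultiplicative norm with \<open>norm 1 = 1\<close>; the latter excludes only the zero algebra.
\<close>

class unital_cstar_algebra = real_normed_algebra_1 + banach +
  fixes scaleC :: "complex \<Rightarrow> 'a \<Rightarrow> 'a" (infixr \<open>*\<^sub>C\<close> 75)
    and star :: "'a \<Rightarrow> 'a"
  assumes scaleC_add_right: "c *\<^sub>C (x + y) = c *\<^sub>C x + c *\<^sub>C y"
    and scaleC_add_left: "(c + d) *\<^sub>C x = c *\<^sub>C x + d *\<^sub>C x"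
    and scaleC_scaleC: "c *\<^sub>C d *\<^sub>C x = (c * d) *\<^sub>C x"
    and scaleC_of_real: "complex_of_real r *\<^sub>C x = r *\<^sub>R x"
    and scaleC_mult_left: "(c *\<^sub>C x) * y = c *\<^sub>C (x * y)"
    and scaleC_mult_right: "x * (c *\<^sub>C y) = c *\<^sub>C (x * y)"
    and norm_scaleC: "norm (c *\<^sub>C x) = cmod c * norm x"
    and star_add: "star (x + y) = star x + star y"
    and star_scaleC: "star (c *\<^sub>C x) = cnj c *\<^sub>C star x"
    and star_mult: "star (x * y) = star y * star x"
    and star_star: "star (star x) = x"
    and cstar_identity: "norm (star x * x) = (norm x)\<^sup>2"

definition cstar_subalgebra :: "'a::unital_cstar_algebra set \<Rightarrow> bool" where
  "cstar_subalgebra A \<longleftrightarrow>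
     closed A \<and> 0 \<in> A \<and>
     (\<forall>x\<in>A. \<forall>y\<in>A. x + y \<in> A \<and> x * y \<in> A) \<and>
     (\<forall>c. \<forall>x\<in>A. c *\<^sub>C x \<in> A) \<and>
     (\<forall>x\<in>A. star x \<in> A)"

definition closed_two_sided_ideal :: "'a::unital_cstar_algebra set \<Rightarrow> bool" where
  "closed_two_sided_ideal A \<longleftrightarrow>
     closed A \<and> 0 \<in> A \<and>
     (\<forall>x\<in>A. \<forall>y\<in>A. x + y \<in> A) \<and>
     (\<forall>c. \<forall>x\<in>A. c *\<^sub>C x \<in> A) \<and>
     (\<forall>a. \<forall>x\<in>A. a * x \<in> A \<and> x * a \<in> A)"

text \<open>The unit in question is a unit of \<open>A\<close> itself, not the unit of the ambient algebra.\<close>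

definition nonunital :: "'a::unital_cstar_algebra set \<Rightarrow> bool" where
  "nonunital A \<longleftrightarrow> \<not> (\<exists>e\<in>A. \<forall>a\<in>A. e * a = a \<and> a * e = a)"

definition isometric_star_automorphism :: "('a::unital_cstar_algebra \<Rightarrow> 'a) \<Rightarrow> bool" where
  "isometric_star_automorphism \<Phi> \<longleftrightarrow>
     bij \<Phi> \<and>
     (\<forall>x y. \<Phi> (x + y) = \<Phi> x + \<Phi> y) \<and>
     (\<forall>c x. \<Phi> (c *\<^sub>C x) = c *\<^sub>C \<Phi> x) \<and>
     (\<forall>x y. \<Phi> (x * y) = \<Phi> x * \<Phi> y) \<and>
     (\<forall>x. \<Phi> (star x) = star (\<Phi> x)) \<and>
     (\<forall>x. norm (\<Phi> x) = norm x)"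

definition directed_preorder :: "'i set \<Rightarrow> ('i \<Rightarrow> 'i \<Rightarrow> bool) \<Rightarrow> bool" where
  "directed_preorder I le \<longleftrightarrow>
     I \<noteq> {} \<and>
     (\<forall>i\<in>I. le i i) \<and>
     (\<forall>i\<in>I. \<forall>j\<in>I. \<forall>k\<in>I. le i j \<longrightarrow> le j k \<longrightarrow> le i k) \<and>
     (\<forall>i\<in>I. \<forall>j\<in>I. \<exists>k\<in>I. le i k \<and> le j k)"

text \<open>
  The filter of tails: convergence of a net indexed by the directed set \<open>(I, le)\<close> is convergence
  along this filter.
\<close>

definition net_filter :: "'i set \<Rightarrow> ('i \<Rightarrow> 'i \<Rightarrow> bool) \<Rightarrow> 'i filter" where
  "net_filter I le = (INF i\<in>I. principal {j\<in>I. le i j})"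

lemma eventually_net_filter:
  assumes "directed_preorder I le"
  shows "eventually P (net_filter I le) \<longleftrightarrow> (\<exists>i\<in>I. \<forall>j\<in>I. le i j \<longrightarrow> P j)"
proof -
  have "\<exists>k\<in>I. principal {j\<in>I. le k j} \<le> principal {j\<in>I. le i j} \<and>
          principal {j\<in>I. le k j} \<le> principal {j\<in>I. le i' j}"
    if ii: "i \<in> I" "i' \<in> I" for i i'
  proof -
    obtain k where k: "k \<in> I" "le i k" "le i' k"
      using assms ii unfolding directed_preorder_def by blast
    have "le i j \<and> le i' j" if "j \<in> I" "le k j" for j
      using assms ii k that unfolding directed_preorder_def by blast
    with k(1) show ?thesis by (intro bexI[of _ k]) auto
  qed
  moreover have "I \<noteq> {}"
    using assms by (simp add: directed_preorder_def)
  ultimately show ?thesis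
    unfolding net_filter_def by (subst eventually_INF_base) (auto simp: eventually_principal)
qed

text \<open>Approximate units are two-sided; monotonicity of the net is not part of the notion.\<close>

definition approximate_unit ::
  "'a::unital_cstar_algebra set \<Rightarrow> 'i set \<Rightarrow> ('i \<Rightarrow> 'i \<Rightarrow> bool) \<Rightarrow> ('i \<Rightarrow> 'a) \<Rightarrow> bool" where
  "approximate_unit A I le u \<longleftrightarrow>
     directed_preorder I le \<and> (\<forall>i\<in>I. u i \<in> A) \<and>
     (\<forall>a\<in>A. ((\<lambda>i. u i * a) \<longlongrightarrow> a) (net_filter I le) \<and>
            ((\<lambda>i. a * u i) \<longlongrightarrow> a) (net_filter I le))"

definition invertible_elements :: "'a::monoid_mult set" where
  "invertible_elements = {b. \<exists>c. b * c = 1 \<and> c * b = 1}"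

definition inverse_element :: "'a::monoid_mult \<Rightarrow> 'a" where
  "inverse_element b = (THE c. b * c = 1 \<and> c * b = 1)"

definition weighted_op :: "('a::times \<Rightarrow> 'a) \<Rightarrow> 'a \<Rightarrow> 'a \<Rightarrow> 'a" where
  "weighted_op \<Phi> b a = b * \<Phi> a"

definition hypercyclic_on :: "'a::topological_space set \<Rightarrow> ('a \<Rightarrow> 'a) \<Rightarrow> bool" where
  "hypercyclic_on X T \<longleftrightarrow>
     T ` X \<subseteq> X \<and> (\<exists>x\<in>X. top_of_set X closure_of {(T ^^ n) x |n. True} = X)"

text \<open>
  The factors do not commute.  The first product is
  \<open>\<Phi>\<^sup>-\<^sup>n(b) \<Phi>\<^sup>-\<^sup>n\<^sup>+\<^sup>1(b) \<dots> \<Phi>\<^sup>-\<^sup>1(b)\<close>, the second is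
  \<open>\<Phi>\<^sup>n\<^sup>-\<^sup>1(b\<^sup>-\<^sup>1) \<dots> \<Phi>(b\<^sup>-\<^sup>1) b\<^sup>-\<^sup>1\<close>: exponents decrease in absolute value from left to right.
\<close>

definition backward_weight :: "('a::monoid_mult \<Rightarrow> 'a) \<Rightarrow> 'a \<Rightarrow> nat \<Rightarrow> 'a" where
  "backward_weight \<Phi> b n = prod_list (map (\<lambda>j. (inv \<Phi> ^^ j) b) (rev [1..<Suc n]))"

definition forward_inverse_weight :: "('a::monoid_mult \<Rightarrow> 'a) \<Rightarrow> 'a \<Rightarrow> nat \<Rightarrow> 'a" where
  "forward_inverse_weight \<Phi> b n =
     prod_list (map (\<lambda>j. (\<Phi> ^^ j) (inverse_element b)) (rev [0..<n]))"

end

theory Submission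
  imports Defs
begin

text \<open>
  Write \<open>T\<close> for the weighted operator and \<open>S\<close> for its inverse.  Telescoping the weights shows that
  \<open>T\<^sup>n\<close> and \<open>S\<^sup>n\<close> are isometries composed with left multiplication by the two products in (ii), so
  (ii) says \<open>T\<^sup>n q \<rightarrow> 0\<close> and \<open>S\<^sup>n d \<rightarrow> 0\<close> along the sequence.  Both operators are twisted right module
  maps: \<open>T\<^sup>n (x y) = T\<^sup>n x \<cdot> \<Phi>\<^sup>n y\<close>.

  If \<open>T\<close> is hypercyclic, some \<open>x\<close> close to \<open>p\<close> has \<open>T\<^sup>n x\<close> close to \<open>p\<close> with \<open>n\<close> large; then
  \<open>q = x p\<close> and \<open>d = T\<^sup>n x \<cdot> p\<close> work, because \<open>T\<^sup>n q\<close> is close to \<open>p \<cdot> \<Phi>\<^sup>n p = 0\<close> and \<open>S\<^sup>n d\<close> is close to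
  \<open>p \<cdot> \<Phi>\<^sup>-\<^sup>n p = 0\<close>.  Conversely, \<open>q x + S\<^sup>n (d y)\<close> is close to \<open>p\<^sup>2 x\<close> and is moved by \<open>T\<^sup>n\<close> close to
  \<open>p\<^sup>2 y\<close>, which makes \<open>T\<close> topologically transitive, and Birkhoff's theorem applies.
\<close>

section \<open>Hypercyclicity and topological transitivity\<close>

lemma closure_of_eq_iff_dense:
  fixes A :: "'a::metric_space set"
  assumes "S \<subseteq> A"
  shows "top_of_set A closure_of S = A \<longleftrightarrow> (\<forall>x\<in>A. \<forall>e>0. \<exists>y\<in>S. dist y x < e)"
proof -
  have "top_of_set A closure_of S = A \<inter> closure S"
    using assms by (simp add: closure_of_subtopology Int_absorb1)
  moreover have "A \<inter> closure S = A \<longleftrightarrow> (\<forall>x\<in>A. x \<in> closure S)"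
    by blast
  ultimately show ?thesis
    by (simp add: closure_approachable)
qed

lemma funpow_image_subset:
  assumes "f ` A \<subseteq> A" "x \<in> A"
  shows "(f ^^ n) x \<in> A"
  using assms by (induction n) auto

lemma hypercyclic_on_metric_iff:
  fixes A :: "'a::metric_space set"
  assumes "T ` A \<subseteq> A"
  shows "hypercyclic_on A T \<longleftrightarrow> (\<exists>x\<in>A. \<forall>y\<in>A. \<forall>e>0. \<exists>n. dist ((T ^^ n) x) y < e)"
proof -
  have "{(T ^^ n) x |n. True} \<subseteq> A" if "x \<in> A" for x
    using funpow_image_subset[OF assms that] by auto
  then have "top_of_set A closure_of {(T ^^ n) x |n. True} = A \<longleftrightarrow>
      (\<forall>y\<in>A. \<forall>e>0. \<exists>n. dist ((T ^^ n) x) y < e)" if "x \<in> A" for x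
    using that by (subst closure_of_eq_iff_dense) (simp_all add: full_SetCompr_eq)
  with assms show ?thesis
    unfolding hypercyclic_on_def by auto
qed

text \<open>Baire category: the points whose orbit enters a given small ball around a member of a
  countable dense set form a relatively open dense set, and a point common to all these sets has a
  dense orbit.\<close>

theorem Birkhoff_transitivity:
  fixes A :: "'a::complete_space set"
  assumes "closed A" "A \<noteq> {}" "separable_space (top_of_set A)"
    and cont: "continuous_on A T" and inv: "T ` A \<subseteq> A"
    and trans: "\<And>x y e. \<lbrakk>x \<in> A; y \<in> A; e > 0\<rbrakk> \<Longrightarrow> \<exists>z\<in>A. \<exists>n. dist z x < e \<and> dist ((T ^^ n) z) y < e"
  shows "hypercyclic_on A T"
proof -
  obtain D where D: "countable D" "D \<subseteq> A" "top_of_set A closure_of D = A"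
    using assms(3) by (auto simp: separable_space_def)
  have cont_pow: "continuous_on A (T ^^ n)" for n
  proof (induction n)
    case (Suc n)
    have "(T ^^ n) ` A \<subseteq> A"
      using funpow_image_subset[OF inv] by blast
    then show ?case
      using continuous_on_compose2[OF cont Suc] by (simp add: comp_def)
  qed (simp add: id_def)
  define G where "G = (\<lambda>(d, k::nat). {z\<in>A. \<exists>n. dist ((T ^^ n) z) d < 1 / real (Suc k)})"
  have G_open: "openin (top_of_set A) (G (d, k))" for d k
  proof -
    have "G (d, k) = (\<Union>n. A \<inter> (T ^^ n) -` ball d (1 / real (Suc k)))"
      by (auto simp: G_def dist_commute)
    also have "openin (top_of_set A) \<dots>"
    proof (intro openin_Union ballI, elim imageE, hypsubst)
      show "openin (top_of_set A) (A \<inter> (T ^^ n) -` ball d (1 / real (Suc k)))" for n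
        using cont_pow by (rule continuous_openin_preimage_gen) simp
    qed
    finally show ?thesis .
  qed
  have G_dense: "top_of_set A closure_of G (d, k) = A" if "d \<in> D" for d k
  proof (subst closure_of_eq_iff_dense)
    show "G (d, k) \<subseteq> A"
      by (auto simp: G_def)
    show "\<forall>x\<in>A. \<forall>e>0. \<exists>y\<in>G (d, k). dist y x < e"
    proof (intro ballI allI impI)
      fix x and e :: real assume "x \<in> A" "e > 0"
      moreover have "d \<in> A"
        using that D(2) by blast
      ultimately obtain z n where "z \<in> A" "dist z x < min e (1 / real (Suc k))"
          "dist ((T ^^ n) z) d < min e (1 / real (Suc k))"
        using trans[of x d "min e (1 / real (Suc k))"] by auto
      then show "\<exists>y\<in>G (d, k). dist y x < e"
        by (intro bexI[of _ z]) (auto simp: G_def)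
    qed
  qed
  have "completely_metrizable_space (top_of_set A)"
    using assms(1) completely_metrizable_space_closedin completely_metrizable_space_euclidean
    by (metis closed_closedin)
  then have "top_of_set A closure_of \<Inter> (G ` (D \<times> UNIV)) = topspace (top_of_set A)"
    using D(1) G_open G_dense by (intro Baire_category) auto
  then have "\<Inter> (G ` (D \<times> UNIV)) \<noteq> {}"
    using assms(2) by force
  then obtain x where x: "\<And>d k. d \<in> D \<Longrightarrow> x \<in> G (d, k)"
    by auto
  \<comment> \<open>So far \<open>x\<close> is only known to lie in the sets
    \<open>G (d, k)\<close>, so some \<open>d\<close> is required to conclude that it lies in
    \<open>A\<close>.\<close>
  have "D \<noteq> {}"
    using D(3) assms(2) by auto
  then have "x \<in> A"
    using x by (auto simp: G_def)
  moreover have "\<exists>n. dist ((T ^^ n) x) y < e" if "y \<in> A" "e > 0" for y e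
  proof -
    have "e / 2 > 0"
      using \<open>e > 0\<close> by simp
    then obtain d where d: "d \<in> D" "dist d y < e / 2"
      using D(3) \<open>y \<in> A\<close> unfolding closure_of_eq_iff_dense[OF D(2)] by blast
    obtain k where k: "1 / real (Suc k) < e / 2"
      using nat_approx_posE[OF \<open>e / 2 > 0\<close>] by blast
    obtain n where "dist ((T ^^ n) x) d < 1 / real (Suc k)"
      using x[OF d(1), of k] by (auto simp: G_def)
    then have "dist ((T ^^ n) x) y < e"
      using d k dist_triangle[of "(T ^^ n) x" y d] by linarith
    then show ?thesis ..
  qed
  ultimately show ?thesis
    using hypercyclic_on_metric_iff[OF inv] by blast
qed

text \<open>
  Without isolated points, the finitely many orbit elements of index below \<open>N\<close> can be avoided.
\<close>

lemma dense_orbit_tail: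
  fixes A :: "'a::metric_space set" and u :: "nat \<Rightarrow> 'a"
  assumes perfect: "\<And>x. x \<in> A \<Longrightarrow> x islimpt A"
    and orbit: "\<And>y e. \<lbrakk>y \<in> A; e > 0\<rbrakk> \<Longrightarrow> \<exists>n. dist (u n) y < e"
    and "y \<in> A" "e > 0"
  shows "\<exists>n\<ge>N. dist (u n) y < e"
proof -
  have "infinite (A \<inter> ball y e)"
    using perfect[OF \<open>y \<in> A\<close>] \<open>e > 0\<close> by (simp add: islimpt_eq_infinite_ball)
  then have "\<not> A \<inter> ball y e \<subseteq> u ` {..<N}"
    by (metis finite_imageI finite_lessThan finite_subset)
  then obtain w where w: "w \<in> A" "dist y w < e" "w \<notin> u ` {..<N}"
    by (metis IntE mem_ball subsetI)
  obtain r where r: "r > 0" "\<And>n. n < N \<Longrightarrow> r \<le> dist w (u n)"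
    using finite_set_avoid[of "u ` {..<N}" w] w(3) by (metis finite_imageI finite_lessThan imageI lessThan_iff)
  \<comment> \<open>The bound \<open>r\<close> rules out every index below \<open>N\<close>; the
    slack \<open>e - dist y w\<close> keeps the orbit point within \<open>e\<close> of
    \<open>y\<close>.\<close>
  obtain n where n: "dist (u n) w < min r (e - dist y w)"
    using orbit[OF w(1), of "min r (e - dist y w)"] r(1) w(2) by auto
  have "\<not> n < N"
    using r(2)[of n] n by (auto simp: dist_commute)
  moreover have "dist (u n) y < e"
    using n dist_triangle[of "u n" y w] by (simp add: dist_commute)
  ultimately show ?thesis
    by (meson not_less)
qed

text \<open>Both approximations come from one dense orbit: \<open>x\<close> is an orbit point near
  \<open>y\<close>, and a sufficiently late orbit point near \<open>z\<close> is an iterate of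
  \<open>x\<close>.\<close>

lemma hypercyclic_imp_return:
  fixes A :: "'a::metric_space set"
  assumes perfect: "\<And>x. x \<in> A \<Longrightarrow> x islimpt A"
    and inv: "T ` A \<subseteq> A" and "hypercyclic_on A T" and "y \<in> A" "z \<in> A" "e > 0"
  shows "\<exists>x\<in>A. \<exists>n\<ge>N. dist x y < e \<and> dist ((T ^^ n) x) z < e"
proof -
  obtain v where v: "v \<in> A" "\<And>y e. \<lbrakk>y \<in> A; e > 0\<rbrakk> \<Longrightarrow> \<exists>n. dist ((T ^^ n) v) y < e"
    using assms(3) hypercyclic_on_metric_iff[OF inv] by blast
  have tail: "\<exists>n\<ge>N. dist ((T ^^ n) v) y < e" if "y \<in> A" for N y
    using dense_orbit_tail[of A "\<lambda>n. (T ^^ n) v" y e N] perfect v(2) that \<open>e > 0\<close> by blast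
  obtain m where m: "dist ((T ^^ m) v) y < e"
    using tail[OF \<open>y \<in> A\<close>] by blast
  obtain l where l: "l \<ge> N + m" "dist ((T ^^ l) v) z < e"
    using tail[OF \<open>z \<in> A\<close>] by blast
  have "(T ^^ (l - m)) ((T ^^ m) v) = (T ^^ l) v"
    using l(1) by (metis add_leD2 comp_apply funpow_add le_add_diff_inverse2)
  then show ?thesis
    using m l funpow_image_subset[OF inv v(1)]
    by (intro bexI[of _ "(T ^^ m) v"] exI[of _ "l - m"]) auto
qed

text \<open>A small nonzero multiple of \<open>v\<close> moves \<open>x\<close> within the subspace.
  This supplies the absence of isolated points behind late orbit visits.\<close>

lemma islimpt_real_subspace:
  fixes A :: "'a::real_normed_vector set"
  assumes "subspace A" "v \<in> A" "v \<noteq> 0" "x \<in> A"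
  shows "x islimpt A"
  unfolding islimpt_approachable
proof (intro allI impI)
  fix e :: real assume "e > 0"
  define t where "t = e / (2 * norm v)"
  have "x + t *\<^sub>R v \<in> A"
    using assms by (simp add: subspace_add subspace_scale)
  moreover have "x + t *\<^sub>R v \<noteq> x" "dist (x + t *\<^sub>R v) x < e"
    using \<open>e > 0\<close> \<open>v \<noteq> 0\<close> by (auto simp: t_def dist_norm)
  ultimately show "\<exists>x'\<in>A. x' \<noteq> x \<and> dist x' x < e"
    by blast
qed

section \<open>Weighted automorphisms\<close>

lemma inverse_element_eq:
  assumes "b * c = 1" "c * b = 1"
  shows "inverse_element b = c"
  unfolding inverse_element_def
proof (rule the_equality)
  fix d assume "b * d = 1 \<and> d * b = 1"
  then show "d = c"
    using assms by (metis mult.assoc mult_1 mult_1_right)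
qed (use assms in simp)

lemma prod_list_rev_upt_Suc:
  assumes "m \<le> n"
  shows "prod_list (map f (rev [m..<Suc n])) = f n * prod_list (map f (rev [m..<n]))"
  using assms by simp

text \<open>The inverse of \<open>b\<close> is a parameter \<open>c\<close>, so calculations rest on
  two product equations; \<open>inverse_element\<close> enters only through the forward
  weight.\<close>

locale weighted_automorphism =
  fixes \<Phi> :: "'a::unital_cstar_algebra \<Rightarrow> 'a" and b c :: 'a
  assumes automorphism: "isometric_star_automorphism \<Phi>"
    and right_inverse: "b * c = 1" and left_inverse: "c * b = 1"
begin

abbreviation "T \<equiv> weighted_op \<Phi> b"

definition S :: "'a \<Rightarrow> 'a" where
  "S a = inv \<Phi> (c * a)"

lemma bij: "bij \<Phi>"
  and add: "\<Phi> (x + y) = \<Phi> x + \<Phi> y"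
  and mult: "\<Phi> (x * y) = \<Phi> x * \<Phi> y"
  and star: "\<Phi> (star x) = star (\<Phi> x)"
  and norm: "norm (\<Phi> x) = norm x"
  using automorphism by (auto simp: isometric_star_automorphism_def)

lemma inv_left [simp]: "inv \<Phi> (\<Phi> x) = x"
  and inv_right [simp]: "\<Phi> (inv \<Phi> x) = x"
  using bij by (simp_all add: bij_is_inj bij_is_surj surj_f_inv_f)

lemma inv_mult: "inv \<Phi> (x * y) = inv \<Phi> x * inv \<Phi> y"
  using mult by (metis inv_left inv_right)

lemma norm_inv: "norm (inv \<Phi> x) = norm x"
  using norm by (metis inv_right)

lemma diff: "\<Phi> (x - y) = \<Phi> x - \<Phi> y"
  using add[of "x - y" y] by simp

lemma funpow_mult: "(\<Phi> ^^ n) (x * y) = (\<Phi> ^^ n) x * (\<Phi> ^^ n) y"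
  by (induction n) (auto simp: mult)

lemma funpow_inv_mult: "(inv \<Phi> ^^ n) (x * y) = (inv \<Phi> ^^ n) x * (inv \<Phi> ^^ n) y"
  by (induction n) (auto simp: inv_mult)

lemma funpow_norm: "norm ((\<Phi> ^^ n) x) = norm x"
  by (induction n) (auto simp: norm)

lemma funpow_inv_norm: "norm ((inv \<Phi> ^^ n) x) = norm x"
  by (induction n) (auto simp: norm_inv)

lemma funpow_star: "(\<Phi> ^^ n) (star x) = star ((\<Phi> ^^ n) x)"
  by (induction n) (auto simp: star)

lemma funpow_inv_left [simp]: "(inv \<Phi> ^^ n) ((\<Phi> ^^ n) x) = x"
  by (induction n arbitrary: x) (simp_all add: funpow_swap1)

lemma funpow_inv_right [simp]: "(\<Phi> ^^ n) ((inv \<Phi> ^^ n) x) = x"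
  by (induction n arbitrary: x) (simp_all add: funpow_swap1)

lemma T_S [simp]: "T (S x) = x"
  using right_inverse by (simp add: weighted_op_def S_def flip: mult.assoc)

lemma S_T [simp]: "S (T x) = x"
  using left_inverse by (simp add: weighted_op_def S_def flip: mult.assoc)

lemma funpow_T_S [simp]: "(T ^^ n) ((S ^^ n) x) = x"
  by (induction n arbitrary: x) (simp_all add: funpow_swap1)

lemma funpow_S_T [simp]: "(S ^^ n) ((T ^^ n) x) = x"
  by (induction n arbitrary: x) (simp_all add: funpow_swap1)

lemma funpow_T_add: "(T ^^ n) (x + y) = (T ^^ n) x + (T ^^ n) y"
  by (induction n) (auto simp: weighted_op_def add distrib_left)

lemma funpow_T_mult: "(T ^^ n) (x * y) = (T ^^ n) x * (\<Phi> ^^ n) y"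
  by (induction n) (auto simp: weighted_op_def mult mult.assoc)

lemma funpow_S_mult: "(S ^^ n) (x * y) = (S ^^ n) x * (inv \<Phi> ^^ n) y"
  by (induction n) (auto simp: S_def inv_mult simp flip: mult.assoc)

lemma continuous_on_T: "continuous_on X T"
proof -
  have "continuous_on X \<Phi>"
    unfolding continuous_on_iff by (metis diff dist_norm norm)
  then show ?thesis
    unfolding weighted_op_def by (intro continuous_intros)
qed

text \<open>The new leftmost factor of the weight is \<open>b\<close> moved back by
  \<open>Suc n\<close> steps; \<open>\<Phi> ^^ Suc n\<close> turns it into the \<open>b\<close> of
  the last application of \<open>T\<close>.\<close>

lemma funpow_T_eq: "(T ^^ n) a = (\<Phi> ^^ n) (backward_weight \<Phi> b n * a)"
proof (induction n)
  case (Suc n)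
  have "backward_weight \<Phi> b (Suc n) = (inv \<Phi> ^^ Suc n) b * backward_weight \<Phi> b n"
    unfolding backward_weight_def by (rule prod_list_rev_upt_Suc) simp
  then have "(\<Phi> ^^ Suc n) (backward_weight \<Phi> b (Suc n) * a) =
      b * (\<Phi> ^^ Suc n) (backward_weight \<Phi> b n * a)"
    by (simp only: funpow_mult funpow_inv_right mult.assoc)
  then show ?case
    by (simp only: funpow.simps comp_apply Suc) (simp add: weighted_op_def)
qed (simp add: backward_weight_def)

text \<open>Here \<open>inv \<Phi> ^^ n\<close> returns the new leftmost factor to \<open>c\<close>,
  and one more \<open>inv \<Phi>\<close> completes an application of \<open>S\<close>.\<close>

lemma funpow_S_eq: "(S ^^ n) a = (inv \<Phi> ^^ n) (forward_inverse_weight \<Phi> b n * a)"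
proof (induction n)
  case (Suc n)
  have "forward_inverse_weight \<Phi> b (Suc n) = (\<Phi> ^^ n) c * forward_inverse_weight \<Phi> b n"
    unfolding forward_inverse_weight_def inverse_element_eq[OF right_inverse left_inverse]
    by (rule prod_list_rev_upt_Suc) simp
  then show ?case
    by (simp only: funpow.simps comp_apply Suc) (simp add: S_def funpow_inv_mult mult.assoc)
qed (simp add: forward_inverse_weight_def)

lemma norm_backward_weight: "norm (backward_weight \<Phi> b n * a) = norm ((T ^^ n) a)"
  by (simp add: funpow_T_eq funpow_norm)

lemma norm_forward_inverse_weight: "norm (forward_inverse_weight \<Phi> b n * a) = norm ((S ^^ n) a)"
  by (simp add: funpow_S_eq funpow_inv_norm)

text \<open>All four vectors are a small error times a factor of norm at most 1; in the last two the
  main term vanishes by orthogonality.\<close>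

lemma close_to_orthogonal:
  assumes "star p = p" "norm p \<le> 1" "(\<Phi> ^^ n) p * p = 0"
    and "norm (x - p) < e" "norm ((T ^^ n) x - p) < e"
  shows "norm (x * p - p\<^sup>2) < e" "norm ((T ^^ n) x * p - p\<^sup>2) < e"
    "norm ((T ^^ n) (x * p)) < e" "norm ((S ^^ n) ((T ^^ n) x * p)) < e"
proof -
  have shrink: "norm (z * u) < e" if "norm z < e" "norm u \<le> 1" for z u :: 'a
    using norm_mult_ineq[of z u] mult_left_mono[OF that(2), of "norm z"] that(1) by simp
  show "norm (x * p - p\<^sup>2) < e" "norm ((T ^^ n) x * p - p\<^sup>2) < e"
    using shrink[OF assms(4,2)] shrink[OF assms(5,2)]
    by (simp_all add: power2_eq_square left_diff_distrib)
  \<comment> \<open>Adjoints reverse the vanishing product, as \<open>p\<close> and its translate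
    are self-adjoint.\<close>
  have "star 0 = (0::'a)"
    using star_add[of 0 "0::'a"] by simp
  then have "p * (\<Phi> ^^ n) p = 0"
    using assms(1,3) by (metis star_mult funpow_star)
  then have "(T ^^ n) (x * p) = ((T ^^ n) x - p) * (\<Phi> ^^ n) p"
    by (simp add: funpow_T_mult left_diff_distrib)
  then show "norm ((T ^^ n) (x * p)) < e"
    using shrink[OF assms(5), of "(\<Phi> ^^ n) p"] assms(2) by (simp add: funpow_norm)
  \<comment> \<open>Moving the vanishing product back by \<open>n\<close> steps gives the second
    orthogonality, already in the right order.\<close>
  have "(inv \<Phi> ^^ n) 0 = 0"
    using funpow_inv_norm[of n 0] by simp
  then have "p * (inv \<Phi> ^^ n) p = 0"
    using assms(3) by (metis funpow_inv_left funpow_inv_mult)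
  then have "(S ^^ n) ((T ^^ n) x * p) = (x - p) * (inv \<Phi> ^^ n) p"
    by (simp add: funpow_S_mult left_diff_distrib)
  then show "norm ((S ^^ n) ((T ^^ n) x * p)) < e"
    using shrink[OF assms(4), of "(inv \<Phi> ^^ n) p"] assms(2) by (simp add: funpow_inv_norm)
qed

end

section \<open>Invariant ideals and the two implications\<close>

lemma subspace_closed_two_sided_ideal:
  assumes "closed_two_sided_ideal A"
  shows "subspace A"
  using assms unfolding subspace_def closed_two_sided_ideal_def
  by (metis scaleC_of_real)

text \<open>In the zero algebra, 0 itself is a unit.\<close>

lemma nonunital_imp_nonzero:
  assumes "nonunital A" "0 \<in> A"
  obtains v where "v \<in> A" "v \<noteq> 0"
  using assms unfolding nonunital_def by (metis mult_zero_left)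

locale invariant_ideal = weighted_automorphism +
  fixes A
  assumes ideal: "closed_two_sided_ideal A" and image: "\<Phi> ` A = A"
begin

lemma ideal_mult: "x \<in> A \<Longrightarrow> a * x \<in> A" "x \<in> A \<Longrightarrow> x * a \<in> A"
  using ideal by (auto simp: closed_two_sided_ideal_def)

lemma ideal_add: "x \<in> A \<Longrightarrow> y \<in> A \<Longrightarrow> x + y \<in> A"
  using ideal by (auto simp: closed_two_sided_ideal_def)

lemma T_image: "T ` A \<subseteq> A"
  using image by (auto simp: weighted_op_def intro!: ideal_mult(1))

lemma S_image: "S ` A \<subseteq> A"
proof -
  have "inv \<Phi> x \<in> A" if "x \<in> A" for x
    using that image by (metis imageE inv_left)
  then show ?thesis
    by (auto simp: S_def intro: ideal_mult)
qed

text \<open>\<open>u\<close> stands for some \<open>(p \<alpha>)\<^sup>2\<close>, which acts on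
  \<open>x\<close> and \<open>y\<close> almost as a unit. Of the two summands of the witness, one is
  negligible at time 0 and the other at time \<open>n k\<close>.\<close>

lemma transitive_if_weights:
  fixes n :: "nat \<Rightarrow> nat"
  assumes "\<And>k. q k \<in> A" "\<And>k. d k \<in> A" "x \<in> A" "y \<in> A"
    and q: "(\<lambda>k. norm (q k - u)) \<longlonglongrightarrow> 0" and d: "(\<lambda>k. norm (d k - u)) \<longlonglongrightarrow> 0"
    and Tq: "(\<lambda>k. norm ((T ^^ n k) (q k))) \<longlonglongrightarrow> 0"
    and Sd: "(\<lambda>k. norm ((S ^^ n k) (d k))) \<longlonglongrightarrow> 0"
    and "norm (u * x - x) < e" "norm (u * y - y) < e"
  shows "\<exists>z\<in>A. \<exists>n. dist z x < e \<and> dist ((T ^^ n) z) y < e"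
proof -
  define z where "z k = q k * x + (S ^^ n k) (d k * y)" for k
  \<comment> \<open>The right factors will be images of a fixed vector under isometries: their norms
    are constant although they need not converge.\<close>
  have null_mult: "(\<lambda>k. f k * g k) \<longlonglongrightarrow> 0"
    if "(\<lambda>k. norm (f k)) \<longlonglongrightarrow> 0" "\<And>k. norm (g k) = r" for f g :: "nat \<Rightarrow> 'a" and r
  proof (rule Lim_null_comparison)
    show "(\<lambda>k. norm (f k) * r) \<longlonglongrightarrow> 0"
      using tendsto_mult_left_zero[OF that(1)] by simp
    show "\<forall>\<^sub>F k in sequentially. norm (f k * g k) \<le> norm (f k) * r"
      by (intro always_eventually allI) (metis norm_mult_ineq that(2))
  qed
  have lim: "(\<lambda>k. f k * w) \<longlonglongrightarrow> u * w" if "(\<lambda>k. norm (f k - u)) \<longlonglongrightarrow> 0"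
    for f :: "nat \<Rightarrow> 'a" and w
    by (intro tendsto_mult tendsto_const LIM_zero_cancel[OF tendsto_norm_zero_cancel[OF that]])
  have "(\<lambda>k. (S ^^ n k) (d k * y)) \<longlonglongrightarrow> 0"
    unfolding funpow_S_mult using Sd by (rule null_mult) (rule funpow_inv_norm)
  from tendsto_add[OF lim[OF q] this] have "z \<longlonglongrightarrow> u * x"
    by (simp add: z_def [abs_def])
  moreover have "(\<lambda>k. (T ^^ n k) (q k * x)) \<longlonglongrightarrow> 0"
    unfolding funpow_T_mult using Tq by (rule null_mult) (rule funpow_norm)
  from tendsto_add[OF this lim[OF d]] have "(\<lambda>k. (T ^^ n k) (z k)) \<longlonglongrightarrow> u * y"
    by (simp add: z_def funpow_T_add)
  ultimately have "(\<lambda>k. dist (z k) x) \<longlonglongrightarrow> dist (u * x) x"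
      "(\<lambda>k. dist ((T ^^ n k) (z k)) y) \<longlonglongrightarrow> dist (u * y) y"
    by (auto intro: tendsto_dist)
  then have "\<forall>\<^sub>F k in sequentially. dist (z k) x < e \<and> dist ((T ^^ n k) (z k)) y < e"
    using assms(9,10) by (intro eventually_conj) (auto dest: order_tendstoD(2) simp: dist_norm)
  then obtain k where "dist (z k) x < e" "dist ((T ^^ n k) (z k)) y < e"
    using eventually_happens' sequentially_bot by blast
  moreover have "z k \<in> A"
    unfolding z_def using assms(1,2)
    by (intro ideal_add funpow_image_subset[OF S_image] ideal_mult(2)) auto
  ultimately show ?thesis
    by blast
qed

lemma hypercyclic_imp_weights:
  assumes "hypercyclic_on A T" "v \<in> A" "v \<noteq> 0"
    and p: "p \<in> A" "star p = p" "norm p \<le> 1"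
    and N: "\<And>n. n \<ge> N \<Longrightarrow> (\<Phi> ^^ n) p * p = 0"
  shows "\<exists>(n :: nat \<Rightarrow> nat) q d. strict_mono n \<and> (\<forall>k. n k \<ge> 1) \<and> (\<forall>k. q k \<in> A) \<and> (\<forall>k. d k \<in> A) \<and>
    (\<lambda>k. norm (q k - p\<^sup>2)) \<longlonglongrightarrow> 0 \<and> (\<lambda>k. norm (d k - p\<^sup>2)) \<longlonglongrightarrow> 0 \<and>
    (\<lambda>k. norm ((T ^^ n k) (q k))) \<longlonglongrightarrow> 0 \<and> (\<lambda>k. norm ((S ^^ n k) (d k))) \<longlonglongrightarrow> 0"
proof -
  have perfect: "x islimpt A" if "x \<in> A" for x
    using islimpt_real_subspace[OF subspace_closed_two_sided_ideal[OF ideal]] assms(2,3) that by blast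
  define P where "P e m q d \<longleftrightarrow> q \<in> A \<and> d \<in> A \<and> norm (q - p\<^sup>2) < e \<and> norm (d - p\<^sup>2) < e \<and>
      norm ((T ^^ m) q) < e \<and> norm ((S ^^ m) d) < e" for e m q d
  have step: "\<exists>m q d. m \<ge> M \<and> P e m q d" if "e > 0" for e M
  proof -
    \<comment> \<open>Source and target are both \<open>p\<close>. The bound \<open>M\<close> serves
      strict growth of the sequence, \<open>N\<close> the orthogonality.\<close>
    from perfect T_image assms(1) p(1) p(1) that
    have "\<exists>x\<in>A. \<exists>m\<ge>max M N. dist x p < e \<and> dist ((T ^^ m) x) p < e"
      by (rule hypercyclic_imp_return)
    then obtain x m where x: "x \<in> A" "m \<ge> max M N" "dist x p < e" "dist ((T ^^ m) x) p < e"
      by blast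
    then have "P e m (x * p) ((T ^^ m) x * p)"
      unfolding P_def using close_to_orthogonal[OF p(2,3) N, of m x e] p(1)
      by (simp add: dist_norm ideal_mult(1))
    with x(2) show ?thesis
      by auto
  qed
  \<comment> \<open>Dependent choice, because each time must exceed the previous one; the error at
    stage \<open>k\<close> is \<open>1 / real (Suc k)\<close>.\<close>
  have "\<exists>f. \<forall>k. (case f k of (m, q, d) \<Rightarrow> m \<ge> 1 \<and> P (1 / real (Suc k)) m q d) \<and>
      fst (f k) < fst (f (Suc k))"
  proof (rule dependent_nat_choice)
    show "\<exists>s. case s of (m, q, d) \<Rightarrow> m \<ge> 1 \<and> P (1 / real (Suc 0)) m q d"
      using step[of "1 / real (Suc 0)" 1] by auto
    show "\<exists>t. (case t of (m, q, d) \<Rightarrow> m \<ge> 1 \<and> P (1 / real (Suc (Suc k))) m q d) \<and> fst s < fst t" for s k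
    proof -
      obtain m q d where "m \<ge> Suc (fst s)" "P (1 / real (Suc (Suc k))) m q d"
        using step[of "1 / real (Suc (Suc k))" "Suc (fst s)"] by auto
      then show ?thesis
        by (intro exI[of _ "(m, q, d)"]) auto
    qed
  qed
  then obtain f where f: "\<And>k. fst (f k) \<ge> 1"
      "\<And>k. P (1 / real (Suc k)) (fst (f k)) (fst (snd (f k))) (snd (snd (f k)))"
      "\<And>k. fst (f k) < fst (f (Suc k))"
    by (auto simp: case_prod_beta)
  have null: "g \<longlonglongrightarrow> 0" if "\<And>k. \<bar>g k\<bar> < 1 / real (Suc k)" for g :: "nat \<Rightarrow> real"
    using that LIMSEQ_Suc[OF lim_1_over_n]
    by (intro Lim_null_comparison[of g "\<lambda>k. 1 / real (Suc k)"]) (auto intro!: always_eventually less_imp_le)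
  show ?thesis
    using f
    by (intro exI[of _ "\<lambda>k. fst (f k)"] exI[of _ "\<lambda>k. fst (snd (f k))"] exI[of _ "\<lambda>k. snd (snd (f k))"])
      (auto simp: P_def strict_mono_Suc_iff intro!: null)
qed

end

theorem proposition4p1:
  fixes A :: "'a::unital_cstar_algebra set"
    and \<Phi> :: "'a \<Rightarrow> 'a"
    and I :: "'i set"
    and le :: "'i \<Rightarrow> 'i \<Rightarrow> bool"
    and p :: "'i \<Rightarrow> 'a"
    and b :: 'a
  assumes "cstar_subalgebra A"
    and "closed_two_sided_ideal A"
    and "nonunital A"
    and "separable_space (top_of_set A)"
    and "isometric_star_automorphism \<Phi>"
    and "\<Phi> ` A = A"
    and "directed_preorder I le"
    and "\<forall>\<alpha>\<in>I. p \<alpha> \<in> A \<and> star (p \<alpha>) = p \<alpha> \<and> norm (p \<alpha>) \<le> 1"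
    and "approximate_unit A I le (\<lambda>\<alpha>. (p \<alpha>)\<^sup>2)"
    and "\<forall>\<alpha>\<in>I. \<exists>N\<ge>1. \<forall>n\<ge>N. (\<Phi> ^^ n) (p \<alpha>) * p \<alpha> = 0"
    and "b \<in> invertible_elements"
  shows "hypercyclic_on A (weighted_op \<Phi> b) \<longleftrightarrow>
    (\<forall>\<alpha>\<in>I. \<exists>(n :: nat \<Rightarrow> nat) (q :: nat \<Rightarrow> 'a) (d :: nat \<Rightarrow> 'a).
       strict_mono n \<and> (\<forall>k. n k \<ge> 1) \<and> (\<forall>k. q k \<in> A) \<and> (\<forall>k. d k \<in> A) \<and>
       (\<lambda>k. norm (q k - (p \<alpha>)\<^sup>2)) \<longlonglongrightarrow> 0 \<and>
       (\<lambda>k. norm (d k - (p \<alpha>)\<^sup>2)) \<longlonglongrightarrow> 0 \<and>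
       (\<lambda>k. norm (backward_weight \<Phi> b (n k) * q k)) \<longlonglongrightarrow> 0 \<and>
       (\<lambda>k. norm (forward_inverse_weight \<Phi> b (n k) * d k)) \<longlonglongrightarrow> 0)"
proof -
  obtain c where "b * c = 1" "c * b = 1"
    using assms(11) by (auto simp: invertible_elements_def)
  then interpret invariant_ideal \<Phi> b c A
    using assms(2,5,6) by unfold_locales
  have "0 \<in> A" "closed A"
    using assms(2) by (auto simp: closed_two_sided_ideal_def)
  obtain v where v: "v \<in> A" "v \<noteq> 0"
    using nonunital_imp_nonzero[OF assms(3) \<open>0 \<in> A\<close>] .
  show ?thesis
    unfolding norm_backward_weight norm_forward_inverse_weight
  proof (intro iffI ballI)
    fix \<alpha> assume hyp: "hypercyclic_on A T" and "\<alpha> \<in> I"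
    then obtain N where "\<And>n. n \<ge> N \<Longrightarrow> (\<Phi> ^^ n) (p \<alpha>) * p \<alpha> = 0"
      using assms(10) by blast
    then show "\<exists>(n :: nat \<Rightarrow> nat) q d. strict_mono n \<and> (\<forall>k. n k \<ge> 1) \<and>
        (\<forall>k. q k \<in> A) \<and> (\<forall>k. d k \<in> A) \<and>
        (\<lambda>k. norm (q k - (p \<alpha>)\<^sup>2)) \<longlonglongrightarrow> 0 \<and> (\<lambda>k. norm (d k - (p \<alpha>)\<^sup>2)) \<longlonglongrightarrow> 0 \<and>
        (\<lambda>k. norm ((T ^^ n k) (q k))) \<longlonglongrightarrow> 0 \<and> (\<lambda>k. norm ((S ^^ n k) (d k))) \<longlonglongrightarrow> 0"
      using hypercyclic_imp_weights[OF hyp v] assms(8) \<open>\<alpha> \<in> I\<close> by blast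
  next
    assume weights: "\<forall>\<alpha>\<in>I. \<exists>(n :: nat \<Rightarrow> nat) q d. strict_mono n \<and> (\<forall>k. n k \<ge> 1) \<and>
        (\<forall>k. q k \<in> A) \<and> (\<forall>k. d k \<in> A) \<and>
        (\<lambda>k. norm (q k - (p \<alpha>)\<^sup>2)) \<longlonglongrightarrow> 0 \<and> (\<lambda>k. norm (d k - (p \<alpha>)\<^sup>2)) \<longlonglongrightarrow> 0 \<and>
        (\<lambda>k. norm ((T ^^ n k) (q k))) \<longlonglongrightarrow> 0 \<and> (\<lambda>k. norm ((S ^^ n k) (d k))) \<longlonglongrightarrow> 0"
    show "hypercyclic_on A T"
    \<comment> \<open>Separability of \<open>A\<close> enters here: the Baire argument uses
      countably many target points.\<close>
    proof (rule Birkhoff_transitivity)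
      fix x y and e :: real assume xy: "x \<in> A" "y \<in> A" "e > 0"
      \<comment> \<open>One index has to serve \<open>x\<close> and \<open>y\<close> at
        once.\<close>
      then have "\<forall>\<^sub>F \<alpha> in net_filter I le. dist ((p \<alpha>)\<^sup>2 * x) x < e \<and> dist ((p \<alpha>)\<^sup>2 * y) y < e"
        using assms(9) by (intro eventually_conj tendstoD) (auto simp: approximate_unit_def)
      then obtain i where "i \<in> I"
        "\<And>\<alpha>. \<alpha> \<in> I \<Longrightarrow> le i \<alpha> \<Longrightarrow> dist ((p \<alpha>)\<^sup>2 * x) x < e \<and> dist ((p \<alpha>)\<^sup>2 * y) y < e"
        unfolding eventually_net_filter[OF assms(7)] by blast
      \<comment> \<open>By reflexivity the starting index of the tail can itself be taken as
        \<open>\<alpha>\<close>.\<close>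
      moreover from \<open>i \<in> I\<close> have "le i i"
        using assms(7) by (simp add: directed_preorder_def)
      ultimately obtain \<alpha> where \<alpha>: "\<alpha> \<in> I" "dist ((p \<alpha>)\<^sup>2 * x) x < e" "dist ((p \<alpha>)\<^sup>2 * y) y < e"
        by blast
      with weights obtain n :: "nat \<Rightarrow> nat" and q d where
        "\<And>k. q k \<in> A" "\<And>k. d k \<in> A"
        "(\<lambda>k. norm (q k - (p \<alpha>)\<^sup>2)) \<longlonglongrightarrow> 0" "(\<lambda>k. norm (d k - (p \<alpha>)\<^sup>2)) \<longlonglongrightarrow> 0"
        "(\<lambda>k. norm ((T ^^ n k) (q k))) \<longlonglongrightarrow> 0" "(\<lambda>k. norm ((S ^^ n k) (d k))) \<longlonglongrightarrow> 0"
        by blast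
      then show "\<exists>z\<in>A. \<exists>n. dist z x < e \<and> dist ((T ^^ n) z) y < e"
        using \<alpha>(2,3) xy by (intro transitive_if_weights) (auto simp: dist_norm)
    qed (use \<open>closed A\<close> \<open>0 \<in> A\<close> assms(4) continuous_on_T T_image in auto)
  qed
qed

end
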